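(* Let $d\ge1$ and $\boldsymbol\rho\in B_d$. The operator $\mathcal H_{\boldsymbol\rho}$ on $\ell^2(\mathbb N_0^d)$ is unitarily equivalent to $\widetilde B_{\boldsymbol\rho}\oplus\mathbf 0$, where $\widetilde B_{\boldsymbol\rho}$ is the operator on $\ell^2(\mathbb N_0)$ with matrix \[ \widetilde B_{\boldsymbol\rho}=\left((-1)^{N+M}(N+M)!\,h_N(\boldsymbol\rho)h_M(\boldsymbol\rho)\right)_{N,M\ge0}. \] Moreover, if $\boldsymbol\rho\ne\mathbf 0$, then $\widetilde B_{\boldsymbol\rho}$ is unitarily equivalent, by a diagonal unitary operator on $\ell^2(\mathbb N_0)$, to the operator \[ B_{\boldsymbol\rho}=D_{\boldsymbol\rho}\,H_{R_{\boldsymbol\rho}/2}\,D_{\boldsymbol\rho}. \]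
   Context: $B_d=\{\boldsymbol\rho=(\rho_1,\dots,\rho_d)\in[0,1]^d:\rho_1+\cdots+\rho_d\le1\}$ and $R_{\boldsymbol\rho}=\rho_1+\cdots+\rho_d$. For $\alpha\in\mathbb N_0^d$, $|\alpha|=\sum_j\alpha_j$ and $\alpha!=\prod_j\alpha_j!$; $0^0=1$. The operator $\mathcal H_{\boldsymbol\rho}$ is the bounded operator on $\ell^2(\mathbb N_0^d)$ with matrix entries \[ (\mathcal H_{\boldsymbol\rho})_{\alpha,\beta}=(-1)^{|\alpha|+|\beta|}\frac{(|\alpha|+|\beta|)!}{\alpha!\,\beta!}\prod_{j=1}^d\left(\frac{\rho_j}{2}\right)^{\alpha_j+\beta_j}. \] For $N\in\mathbb N_0$, $h_N(\boldsymbol\rho)\ge0$ is defined by \[ h_N(\boldsymbol\rho)^2=\sum_{|\alpha|=N}\frac1{(\alpha!)^2}\prod_{j=1}^d\left(\frac{\rho_j}{2}\right)^{2\alpha_j}. \] For $\boldsymbol\rho\ne\mathbf 0$, $c_N(\boldsymbol\rho)=\dfrac{h_N(\boldsymbol\rho)}{(R_{\boldsymbol\rho}/2)^N/N!}$ (one has $0<c_N(\boldsymbol\rho)\le1$), and $D_{\boldsymbol\rho}$ is the diagonal operator on $\ell^2(\mathbb N_0)$ with $D_{\boldsymbol\rho}e_N=c_N(\boldsymbol\rho)e_N$. For $0\le t\le\frac12$, $H_t$ is the bounded operator on $\ell^2(\mathbb N_0)$ given by $(H_tx)_j=\sum_{k\ge0}\binom{j+k}{j}t^{j+k}x_k$.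 The symbol $\mathbf 0$ denotes the zero operator on some Hilbert space (possibly the trivial space $\{0\}$). *)

theory Defs
  imports "HOL-Analysis.Analysis" "HOL-Library.Function_Algebras"
begin

section \<open>Complex Hilbert spaces and unitary equivalence\<close>

text \<open>The space is the subset \<open>vecs\<close> of a type whose addition is the ambient one; the scalar
  multiplication and the inner product (linear in the first argument) are data.\<close>

record 'a cspace =
  vecs :: "'a set"
  scl :: "complex \<Rightarrow> 'a \<Rightarrow> 'a"
  ip :: "'a \<Rightarrow> 'a \<Rightarrow> complex"

definition hnorm :: "'a cspace \<Rightarrow> 'a \<Rightarrow> real" where
  "hnorm V x = sqrt (Re (ip V x x))"

definition hilbert_space :: "'a::ab_group_add cspace \<Rightarrow> bool" where
  "hilbert_space V \<longleftrightarrow>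
     vector_space (scl V) \<and> module.subspace (scl V) (vecs V) \<and>
     (\<forall>x\<in>vecs V. \<forall>y\<in>vecs V. \<forall>z\<in>vecs V. ip V (x + y) z = ip V x z + ip V y z) \<and>
     (\<forall>c. \<forall>x\<in>vecs V. \<forall>y\<in>vecs V. ip V (scl V c x) y = c * ip V x y) \<and>
     (\<forall>x\<in>vecs V. \<forall>y\<in>vecs V. ip V y x = cnj (ip V x y)) \<and>
     (\<forall>x\<in>vecs V. 0 \<le> Re (ip V x x) \<and> (ip V x x = 0 \<longrightarrow> x = 0)) \<and>
     (\<forall>X::nat \<Rightarrow> 'a. range X \<subseteq> vecs V \<and>
        (\<forall>e>0. \<exists>N. \<forall>m\<ge>N. \<forall>n\<ge>N. hnorm V (X m - X n) < e) \<longrightarrow>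
        (\<exists>x\<in>vecs V. (\<lambda>n. hnorm V (X n - x)) \<longlonglongrightarrow> 0))"

definition linear_map :: "'a::ab_group_add cspace \<Rightarrow> 'b::ab_group_add cspace \<Rightarrow> ('a \<Rightarrow> 'b) \<Rightarrow> bool"
where
  "linear_map V W T \<longleftrightarrow> T ` vecs V \<subseteq> vecs W \<and>
     (\<forall>x\<in>vecs V. \<forall>y\<in>vecs V. T (x + y) = T x + T y) \<and>
     (\<forall>c. \<forall>x\<in>vecs V. T (scl V c x) = scl W c (T x))"

definition bounded_operator :: "'a::ab_group_add cspace \<Rightarrow> ('a \<Rightarrow> 'a) \<Rightarrow> bool" where
  "bounded_operator V T \<longleftrightarrow> linear_map V V T \<and> (\<exists>C. \<forall>x\<in>vecs V. hnorm V (T x) \<le> C * hnorm V x)"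

definition unitary :: "'a::ab_group_add cspace \<Rightarrow> 'b::ab_group_add cspace \<Rightarrow> ('a \<Rightarrow> 'b) \<Rightarrow> bool"
where
  "unitary V W U \<longleftrightarrow> linear_map V W U \<and> bij_betw U (vecs V) (vecs W) \<and>
     (\<forall>x\<in>vecs V. \<forall>y\<in>vecs V. ip W (U x) (U y) = ip V x y)"

definition unitarily_equivalent_by ::
  "('a \<Rightarrow> 'b) \<Rightarrow> 'a::ab_group_add cspace \<Rightarrow> ('a \<Rightarrow> 'a) \<Rightarrow> 'b::ab_group_add cspace \<Rightarrow> ('b \<Rightarrow> 'b) \<Rightarrow> bool"
where
  "unitarily_equivalent_by U V T W S \<longleftrightarrow>
     bounded_operator V T \<and> bounded_operator W S \<and> unitary V W U \<and>
     (\<forall>x\<in>vecs V. U (T x) = S (U x))"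

definition unitarily_equivalent ::
  "'a::ab_group_add cspace \<Rightarrow> ('a \<Rightarrow> 'a) \<Rightarrow> 'b::ab_group_add cspace \<Rightarrow> ('b \<Rightarrow> 'b) \<Rightarrow> bool" where
  "unitarily_equivalent V T W S \<longleftrightarrow> (\<exists>U. unitarily_equivalent_by U V T W S)"

definition direct_sum :: "'a cspace \<Rightarrow> 'b cspace \<Rightarrow> ('a \<times> 'b) cspace" where
  "direct_sum V W =
     \<lparr>vecs = vecs V \<times> vecs W,
      scl = (\<lambda>c (x, y). (scl V c x, scl W c y)),
      ip = (\<lambda>(x, y) (x', y'). ip V x x' + ip W y y')\<rparr>"

definition direct_sum_op :: "('a \<Rightarrow> 'a) \<Rightarrow> ('b \<Rightarrow> 'b) \<Rightarrow> 'a \<times> 'b \<Rightarrow> 'a \<times> 'b" where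
  "direct_sum_op T S = map_prod T S"

definition zero_op :: "'a \<Rightarrow> 'a::zero" where
  "zero_op x = 0"

section \<open>The sequence spaces and operators given by matrices\<close>

definition l2 :: "('i \<Rightarrow> complex) cspace" where
  "l2 = \<lparr>vecs = {x. (\<lambda>i. (cmod (x i))\<^sup>2) summable_on UNIV},
         scl = (\<lambda>c x i. c * x i),
         ip = (\<lambda>x y. \<Sum>\<^sub>\<infinity>i. x i * cnj (y i))\<rparr>"

text \<open>\<open>matrix_op M\<close> always sends the \<open>j\<close>-th unit vector to the \<open>j\<close>-th column of \<open>M\<close>. So whenever
  it is a bounded operator on \<open>l2\<close> (which \<open>unitarily_equivalent_by\<close> includes), it is the
  bounded operator with matrix \<open>M\<close>.\<close>

definition matrix_op :: "('i \<Rightarrow> 'i \<Rightarrow> real) \<Rightarrow> ('i \<Rightarrow> complex) \<Rightarrow> ('i \<Rightarrow> complex)" where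
  "matrix_op M x = (\<lambda>i. \<Sum>\<^sub>\<infinity>j. complex_of_real (M i j) * x j)"

definition diag_op :: "('i \<Rightarrow> complex) \<Rightarrow> ('i \<Rightarrow> complex) \<Rightarrow> ('i \<Rightarrow> complex)" where
  "diag_op w x = (\<lambda>i. w i * x i)"

section \<open>The operators attached to a parameter vector\<close>

definition param_simplex :: "(real ^ 'd) set" where
  "param_simplex = {\<rho>. (\<forall>j. 0 \<le> \<rho> $ j \<and> \<rho> $ j \<le> 1) \<and> (\<Sum>j\<in>UNIV. \<rho> $ j) \<le> 1}"

definition R_of :: "real ^ 'd \<Rightarrow> real" where
  "R_of \<rho> = (\<Sum>j\<in>UNIV. \<rho> $ j)"

definition mi_size :: "nat ^ 'd \<Rightarrow> nat" where
  "mi_size \<alpha> = (\<Sum>j\<in>UNIV. \<alpha> $ j)"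

definition mi_fact :: "nat ^ 'd \<Rightarrow> real" where
  "mi_fact \<alpha> = (\<Prod>j\<in>UNIV. fact (\<alpha> $ j))"

definition calH :: "real ^ 'd \<Rightarrow> (nat ^ 'd \<Rightarrow> complex) \<Rightarrow> (nat ^ 'd \<Rightarrow> complex)" where
  "calH \<rho> = matrix_op (\<lambda>\<alpha> \<beta>.
     (-1) ^ (mi_size \<alpha> + mi_size \<beta>) * (fact (mi_size \<alpha> + mi_size \<beta>) / (mi_fact \<alpha> * mi_fact \<beta>)) *
     (\<Prod>j\<in>UNIV. (\<rho> $ j / 2) ^ (\<alpha> $ j + \<beta> $ j)))"

definition h_coef :: "real ^ 'd \<Rightarrow> nat \<Rightarrow> real" where
  "h_coef \<rho> N = sqrt (\<Sum>\<alpha> | mi_size \<alpha> = N.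
     1 / (mi_fact \<alpha>)\<^sup>2 * (\<Prod>j\<in>UNIV. (\<rho> $ j / 2) ^ (2 * \<alpha> $ j)))"

definition B_tilde :: "real ^ 'd \<Rightarrow> (nat \<Rightarrow> complex) \<Rightarrow> (nat \<Rightarrow> complex)" where
  "B_tilde \<rho> = matrix_op (\<lambda>N M. (-1) ^ (N + M) * fact (N + M) * h_coef \<rho> N * h_coef \<rho> M)"

definition c_coef :: "real ^ 'd \<Rightarrow> nat \<Rightarrow> real" where
  "c_coef \<rho> N = h_coef \<rho> N / ((R_of \<rho> / 2) ^ N / fact N)"

definition D_op :: "real ^ 'd \<Rightarrow> (nat \<Rightarrow> complex) \<Rightarrow> (nat \<Rightarrow> complex)" where
  "D_op \<rho> = diag_op (\<lambda>N. complex_of_real (c_coef \<rho> N))"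

definition H_op :: "real \<Rightarrow> (nat \<Rightarrow> complex) \<Rightarrow> (nat \<Rightarrow> complex)" where
  "H_op t = matrix_op (\<lambda>j k. real ((j + k) choose j) * t ^ (j + k))"

definition B_op :: "real ^ 'd \<Rightarrow> (nat \<Rightarrow> complex) \<Rightarrow> (nat \<Rightarrow> complex)" where
  "B_op \<rho> = D_op \<rho> \<circ> H_op (R_of \<rho> / 2) \<circ> D_op \<rho>"

end

theory Submission imports Defs begin

text \<open>On the shell \<open>|\<alpha>| = N\<close> the entries of the matrix depend on \<open>\<alpha>\<close> only through the weight
  \<open>g \<alpha> = (\<Prod>j. (\<rho> $ j / 2) ^ (\<alpha> $ j)) / \<alpha>!\<close>, whose norm on the shell is \<open>h_coef \<rho> N\<close>. Choosing a unit
  vector on each shell with \<open>g = h_coef \<rho> N \<cdot> v\<close> there gives an isometry \<open>V\<close> from the sequences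
  indexed by \<open>N\<close> with \<open>calH \<rho> = V B_tilde V*\<close>, so \<open>x \<mapsto> (V* x, x - V V* x)\<close> is the unitary onto the
  direct sum with the kernel of \<open>V*\<close>. Boundedness comes from the Schur test: by the multinomial
  theorem \<open>h_coef \<rho> N \<le> (R / 2) ^ N / N!\<close>, so the entries are dominated by \<open>(N + M choose N) / 2 ^ (N + M)\<close>,
  whose rows all sum to 2.\<close>

section \<open>Square-summable families\<close>

lemma l2_simps [simp]:
  "vecs l2 = {x. (\<lambda>i. (cmod (x i))\<^sup>2) summable_on UNIV}"
  "scl l2 = (\<lambda>c x i. c * x i)"
  "ip l2 = (\<lambda>x y. \<Sum>\<^sub>\<infinity>i. x i * cnj (y i))"
  by (simp_all add: l2_def)

lemma l2_add:
  assumes "x \<in> vecs l2" "y \<in> vecs l2"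
  shows "x + y \<in> vecs l2"
proof -
  have "(\<lambda>i. 2 * (cmod (x i))\<^sup>2 + 2 * (cmod (y i))\<^sup>2) summable_on UNIV"
    using assms by (intro summable_on_add summable_on_cmult_right) auto
  moreover have "(cmod (x i + y i))\<^sup>2 \<le> 2 * (cmod (x i))\<^sup>2 + 2 * (cmod (y i))\<^sup>2" for i
  proof -
    have "(cmod (x i + y i))\<^sup>2 \<le> (cmod (x i) + cmod (y i))\<^sup>2"
      by (intro power_mono norm_triangle_ineq) auto
    also have "\<dots> \<le> 2 * (cmod (x i))\<^sup>2 + 2 * (cmod (y i))\<^sup>2"
      using sum_squares_bound[of "cmod (x i)" "cmod (y i)"] by (simp add: power2_sum)
    finally show ?thesis .
  qed
  ultimately show ?thesis
    by (auto intro: summable_on_comparison_test)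
qed

lemma l2_scale: "x \<in> vecs l2 \<Longrightarrow> (\<lambda>i. c * x i) \<in> vecs l2"
  by (auto simp: norm_mult power_mult_distrib intro: summable_on_cmult_right)

lemma l2_zero: "0 \<in> vecs l2"
  by simp

lemma l2_diff:
  assumes "x \<in> vecs l2" "y \<in> vecs l2"
  shows "x - y \<in> vecs l2"
proof -
  have "x - y = x + (\<lambda>i. (-1) * y i)"
    by (simp add: fun_eq_iff)
  with assms show ?thesis
    by (metis l2_add l2_scale)
qed

lemma l2_ip_summable:
  assumes "x \<in> vecs l2" "y \<in> vecs l2"
  shows "(\<lambda>i. x i * cnj (y i)) summable_on UNIV"
proof (rule abs_summable_summable, rule summable_on_comparison_test)
  show "(\<lambda>i. (cmod (x i))\<^sup>2 + (cmod (y i))\<^sup>2) summable_on UNIV"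
    using assms by (intro summable_on_add) auto
  show "cmod (x i * cnj (y i)) \<le> (cmod (x i))\<^sup>2 + (cmod (y i))\<^sup>2" for i
    using sum_squares_bound[of "cmod (x i)" "cmod (y i)"]
      mult_nonneg_nonneg[OF norm_ge_zero[of "x i"] norm_ge_zero[of "y i"]]
    unfolding norm_mult complex_mod_cnj mult.assoc by linarith
qed simp

lemma l2_ip_add_left:
  assumes "x \<in> vecs l2" "y \<in> vecs l2" "z \<in> vecs l2"
  shows "ip l2 (x + y) z = ip l2 x z + ip l2 y z"
  using infsum_add[OF l2_ip_summable[OF assms(1,3)] l2_ip_summable[OF assms(2,3)]]
  by (simp add: algebra_simps)

lemma l2_ip_cnj: "ip l2 y x = cnj (ip l2 x y)"
  by (simp flip: infsum_cnj add: mult.commute)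

lemma l2_ip_diff_left:
  assumes "x \<in> vecs l2" "y \<in> vecs l2" "z \<in> vecs l2"
  shows "ip l2 (x - y) z = ip l2 x z - ip l2 y z"
  using l2_ip_add_left[OF l2_diff[OF assms(1,2)] assms(2,3)] by simp

lemma l2_ip_diff_right:
  assumes "x \<in> vecs l2" "y \<in> vecs l2" "z \<in> vecs l2"
  shows "ip l2 z (x - y) = ip l2 z x - ip l2 z y"
  using l2_ip_diff_left[OF assms] l2_ip_cnj by (metis complex_cnj_diff)

lemma l2_ip_self: "ip l2 x x = complex_of_real (\<Sum>\<^sub>\<infinity>i. (cmod (x i))\<^sup>2)"
proof -
  have "ip l2 x x = (\<Sum>\<^sub>\<infinity>i. complex_of_real ((cmod (x i))\<^sup>2))"
    by (simp add: complex_norm_square[symmetric])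
  \<comment> \<open>The real and the complex family are summable together, so the equality holds for
    every \<open>x\<close>: outside \<open>vecs l2\<close> both sums take the default value
    0.\<close>
  also have "\<dots> = complex_of_real (\<Sum>\<^sub>\<infinity>i. (cmod (x i))\<^sup>2)"
    by (rule infsum_bounded_linear_strong)
      (auto simp: bounded_linear_of_real simp del: of_real_power
        dest: summable_on_Re intro: summable_on_of_real)
  finally show ?thesis .
qed

lemma l2_hnorm: "hnorm l2 x = sqrt (\<Sum>\<^sub>\<infinity>i. (cmod (x i))\<^sup>2)"
  by (simp add: hnorm_def l2_ip_self del: l2_simps)

lemma l2_hnorm_sq: "(hnorm l2 x)\<^sup>2 = (\<Sum>\<^sub>\<infinity>i. (cmod (x i))\<^sup>2)"
  by (simp add: l2_hnorm infsum_nonneg)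

lemma hnorm_l2_nonneg [simp]: "0 \<le> hnorm l2 x"
  by (simp add: l2_hnorm infsum_nonneg)

lemma l2_sum_le_hnorm:
  assumes "x \<in> vecs l2" "finite F"
  shows "(\<Sum>i\<in>F. (cmod (x i))\<^sup>2) \<le> (hnorm l2 x)\<^sup>2"
  unfolding l2_hnorm_sq using assms by (intro finite_sum_le_infsum) auto

lemma l2_norm_le_hnorm:
  assumes "x \<in> vecs l2"
  shows "cmod (x i) \<le> hnorm l2 x"
  using l2_sum_le_hnorm[OF assms, of "{i}"] by (auto intro: power2_le_imp_le)

text \<open>Partial sums of nonnegative terms that stay below a bound converge to a sum below that
  bound. Membership and norm estimates of operator images are both obtained from finite sums in this
  way.\<close>

lemma l2_of_bounded_sums:
  assumes "\<And>F. finite F \<Longrightarrow> (\<Sum>i\<in>F. (cmod (x i))\<^sup>2) \<le> C\<^sup>2" "0 \<le> C"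
  shows "x \<in> vecs l2" "hnorm l2 x \<le> C"
proof -
  show x: "x \<in> vecs l2"
    using assms(1) by (auto intro!: nonneg_bdd_above_summable_on bdd_aboveI[of _ "C\<^sup>2"])
  have "(hnorm l2 x)\<^sup>2 \<le> C\<^sup>2"
    unfolding l2_hnorm_sq using x assms(1) by (intro infsum_le_finite_sums) auto
  then show "hnorm l2 x \<le> C"
    using assms(2) by (rule power2_le_imp_le)
qed

text \<open>Coordinates are dominated by the norm, so they are Cauchy and yield a pointwise limit.
  That limit is returned along with the norm limit because closedness of subspaces is checked
  coordinatewise.\<close>

lemma l2_complete:
  fixes X :: "nat \<Rightarrow> 'i \<Rightarrow> complex"
  assumes X: "\<And>n. X n \<in> vecs l2"
    and cauchy: "\<And>e. e > 0 \<Longrightarrow> \<exists>N. \<forall>m\<ge>N. \<forall>n\<ge>N. hnorm l2 (X m - X n) < e"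
  obtains x where "x \<in> vecs l2" "(\<lambda>n. hnorm l2 (X n - x)) \<longlonglongrightarrow> 0"
    "\<And>i. (\<lambda>n. X n i) \<longlonglongrightarrow> x i"
proof -
  have "Cauchy (\<lambda>n. X n i)" for i
  proof (rule metric_CauchyI)
    fix e :: real assume "e > 0"
    then obtain N where N: "\<And>m n. m \<ge> N \<Longrightarrow> n \<ge> N \<Longrightarrow> hnorm l2 (X m - X n) < e"
      using cauchy by blast
    have "dist (X m i) (X n i) < e" if "m \<ge> N" "n \<ge> N" for m n
      using l2_norm_le_hnorm[OF l2_diff[OF X X], of m n i] N[OF that] by (simp add: dist_norm)
    then show "\<exists>M. \<forall>m\<ge>M. \<forall>n\<ge>M. dist (X m i) (X n i) < e"
      by blast
  qed
  then have "\<exists>l. (\<lambda>n. X n i) \<longlonglongrightarrow> l" for i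
    using convergent_eq_Cauchy by blast
  then obtain x where x: "\<And>i. (\<lambda>n. X n i) \<longlonglongrightarrow> x i"
    by metis
  have close: "\<exists>N. \<forall>m\<ge>N. X m - x \<in> vecs l2 \<and> hnorm l2 (X m - x) \<le> e" if e: "e > 0" for e
  proof -
    obtain N where N: "\<And>m n. m \<ge> N \<Longrightarrow> n \<ge> N \<Longrightarrow> hnorm l2 (X m - X n) < e"
      using cauchy[OF e] by blast
    \<comment> \<open>Only finitely many coordinates occur, so \<open>n\<close> may tend to infinity
      under the sum; since \<open>F\<close> is arbitrary, the bound then holds for the whole
      norm.\<close>
    have "(\<Sum>i\<in>F. (cmod ((X m - x) i))\<^sup>2) \<le> e\<^sup>2" if F: "finite F" and m: "m \<ge> N" for F m
    proof (rule Lim_bounded)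
      show "(\<lambda>n. \<Sum>i\<in>F. (cmod ((X m - X n) i))\<^sup>2) \<longlonglongrightarrow> (\<Sum>i\<in>F. (cmod ((X m - x) i))\<^sup>2)"
        by (auto intro!: tendsto_intros x)
      show "\<forall>n\<ge>N. (\<Sum>i\<in>F. (cmod ((X m - X n) i))\<^sup>2) \<le> e\<^sup>2"
      proof (intro allI impI)
        fix n assume "n \<ge> N"
        then have "hnorm l2 (X m - X n) \<le> e"
          using N m by fastforce
        then have "(hnorm l2 (X m - X n))\<^sup>2 \<le> e\<^sup>2"
          by (intro power_mono) auto
        then show "(\<Sum>i\<in>F. (cmod ((X m - X n) i))\<^sup>2) \<le> e\<^sup>2"
          using l2_sum_le_hnorm[OF l2_diff[OF X X] F, of m n] by linarith
      qed
    qed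
    then show ?thesis
      using l2_of_bounded_sums[of "X _ - x" e] e by (intro exI[of _ N] allI impI conjI) auto
  qed
  obtain N where "X N - x \<in> vecs l2"
    using close[of 1] by auto
  then have "X N - (X N - x) \<in> vecs l2"
    using X l2_diff by blast
  then have "x \<in> vecs l2"
    by (simp add: fun_diff_def)
  moreover have "(\<lambda>n. hnorm l2 (X n - x)) \<longlonglongrightarrow> 0"
  proof (rule LIMSEQ_I)
    fix r :: real assume "r > 0"
    then obtain N where "\<forall>m\<ge>N. hnorm l2 (X m - x) \<le> r / 2"
      using close[of "r / 2"] by auto
    then show "\<exists>no. \<forall>n\<ge>no. norm (hnorm l2 (X n - x) - 0) < r"
      using \<open>r > 0\<close> by (intro exI[of _ N]) (fastforce simp: l2_hnorm_sq)
  qed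
  ultimately show ?thesis
    using x that by blast
qed

section \<open>Subspaces of \<open>l2\<close> as Hilbert spaces\<close>

lemma vector_space_l2: "vector_space (scl (l2 :: ('i \<Rightarrow> complex) cspace))"
  by unfold_locales (auto simp: fun_eq_iff algebra_simps)

lemma hnorm_l2_update [simp]: "hnorm (l2\<lparr>vecs := S\<rparr>) = hnorm l2"
  by (simp add: hnorm_def fun_eq_iff)

text \<open>Closedness is asked for pointwise limits lying in \<open>l2\<close>. This is stronger
  than closedness in norm, but immediate for subspaces cut out by equations in finitely many
  coordinates each.\<close>

lemma hilbert_space_l2_subspace:
  fixes S :: "('i \<Rightarrow> complex) set"
  assumes sub: "S \<subseteq> vecs l2" and zero: "0 \<in> S"
    and add: "\<And>x y. x \<in> S \<Longrightarrow> y \<in> S \<Longrightarrow> x + y \<in> S"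
    and scale: "\<And>c x. x \<in> S \<Longrightarrow> (\<lambda>i. c * x i) \<in> S"
    and closed: "\<And>X x. \<lbrakk>\<And>n. X n \<in> S; x \<in> vecs l2; \<And>i. (\<lambda>n. X n i) \<longlonglongrightarrow> x i\<rbrakk> \<Longrightarrow> x \<in> S"
  shows "hilbert_space (l2\<lparr>vecs := S\<rparr>)"
  unfolding hilbert_space_def
proof (intro conjI)
  show vs: "vector_space (scl (l2\<lparr>vecs := S\<rparr>))"
    using vector_space_l2 by simp
  interpret vector_space "scl (l2\<lparr>vecs := S\<rparr>) :: complex \<Rightarrow> ('i \<Rightarrow> complex) \<Rightarrow> _"
    by (rule vs)
  show "module.subspace (scl (l2\<lparr>vecs := S\<rparr>)) (vecs (l2\<lparr>vecs := S\<rparr>))"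
    using zero add scale by (intro subspaceI) auto
  show "\<forall>x\<in>vecs (l2\<lparr>vecs := S\<rparr>). \<forall>y\<in>vecs (l2\<lparr>vecs := S\<rparr>). \<forall>z\<in>vecs (l2\<lparr>vecs := S\<rparr>).
      ip (l2\<lparr>vecs := S\<rparr>) (x + y) z = ip (l2\<lparr>vecs := S\<rparr>) x z + ip (l2\<lparr>vecs := S\<rparr>) y z"
    using sub by (auto simp del: l2_simps intro!: l2_ip_add_left)
  show "\<forall>c. \<forall>x\<in>vecs (l2\<lparr>vecs := S\<rparr>). \<forall>y\<in>vecs (l2\<lparr>vecs := S\<rparr>).
      ip (l2\<lparr>vecs := S\<rparr>) (scl (l2\<lparr>vecs := S\<rparr>) c x) y = c * ip (l2\<lparr>vecs := S\<rparr>) x y"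
    by (simp add: mult.assoc infsum_cmult_right')
  show "\<forall>x\<in>vecs (l2\<lparr>vecs := S\<rparr>). \<forall>y\<in>vecs (l2\<lparr>vecs := S\<rparr>).
      ip (l2\<lparr>vecs := S\<rparr>) y x = cnj (ip (l2\<lparr>vecs := S\<rparr>) x y)"
    by (auto simp del: l2_simps intro!: l2_ip_cnj)
  show "\<forall>x\<in>vecs (l2\<lparr>vecs := S\<rparr>). 0 \<le> Re (ip (l2\<lparr>vecs := S\<rparr>) x x) \<and>
      (ip (l2\<lparr>vecs := S\<rparr>) x x = 0 \<longrightarrow> x = 0)"
  proof (intro ballI conjI impI)
    fix x assume x: "x \<in> vecs (l2\<lparr>vecs := S\<rparr>)"
    show "0 \<le> Re (ip (l2\<lparr>vecs := S\<rparr>) x x)"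
      by (simp add: l2_ip_self infsum_nonneg del: l2_simps)
    assume "ip (l2\<lparr>vecs := S\<rparr>) x x = 0"
    then have "hnorm l2 x = 0"
      by (simp add: hnorm_def del: l2_simps)
    then show "x = 0"
      using l2_norm_le_hnorm[of x] x sub by (fastforce simp: fun_eq_iff simp del: l2_simps)
  qed
  show "\<forall>X :: nat \<Rightarrow> _. range X \<subseteq> vecs (l2\<lparr>vecs := S\<rparr>) \<and>
      (\<forall>e>0. \<exists>N. \<forall>m\<ge>N. \<forall>n\<ge>N. hnorm (l2\<lparr>vecs := S\<rparr>) (X m - X n) < e) \<longrightarrow>
      (\<exists>x\<in>vecs (l2\<lparr>vecs := S\<rparr>). (\<lambda>n. hnorm (l2\<lparr>vecs := S\<rparr>) (X n - x)) \<longlonglongrightarrow> 0)"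
  proof (intro allI impI)
    fix X :: "nat \<Rightarrow> 'i \<Rightarrow> complex"
    assume *: "range X \<subseteq> vecs (l2\<lparr>vecs := S\<rparr>) \<and>
      (\<forall>e>0. \<exists>N. \<forall>m\<ge>N. \<forall>n\<ge>N. hnorm (l2\<lparr>vecs := S\<rparr>) (X m - X n) < e)"
    then have X: "X n \<in> S" for n
      by auto
    obtain x where x: "x \<in> vecs l2" "(\<lambda>n. hnorm l2 (X n - x)) \<longlonglongrightarrow> 0"
      "\<And>i. (\<lambda>n. X n i) \<longlonglongrightarrow> x i"
      using l2_complete[of X] X sub * by (metis hnorm_l2_update subsetD)
    then show "\<exists>x\<in>vecs (l2\<lparr>vecs := S\<rparr>). (\<lambda>n. hnorm (l2\<lparr>vecs := S\<rparr>) (X n - x)) \<longlonglongrightarrow> 0"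
      using closed[OF X x(1,3)] by (auto simp del: l2_simps)
  qed
qed

section \<open>The Schur test\<close>

text \<open>The coordinates of \<open>x\<close> are bounded by its norm, so an absolutely summable
  row dominates each of these series.\<close>

lemma l2_abs_row_summable:
  fixes M :: "'i \<Rightarrow> 'j \<Rightarrow> real"
  assumes "(\<lambda>j. \<bar>M i j\<bar>) summable_on UNIV" "x \<in> vecs l2"
  shows "(\<lambda>j. \<bar>M i j\<bar> * cmod (x j)) summable_on UNIV"
    "(\<lambda>j. \<bar>M i j\<bar> * (cmod (x j))\<^sup>2) summable_on UNIV"
    "(\<lambda>j. complex_of_real (M i j) * x j) summable_on UNIV"
proof -
  have "(\<lambda>j. \<bar>M i j\<bar> * hnorm l2 x) summable_on UNIV"
    using assms(1) by (rule summable_on_cmult_left)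
  then show 1: "(\<lambda>j. \<bar>M i j\<bar> * cmod (x j)) summable_on UNIV"
    using l2_norm_le_hnorm[OF assms(2)]
    by (elim summable_on_comparison_test) (auto intro: mult_left_mono)
  have "(\<lambda>j. \<bar>M i j\<bar> * (hnorm l2 x)\<^sup>2) summable_on UNIV"
    using assms(1) by (rule summable_on_cmult_left)
  then show "(\<lambda>j. \<bar>M i j\<bar> * (cmod (x j))\<^sup>2) summable_on UNIV"
    using l2_norm_le_hnorm[OF assms(2)]
    by (elim summable_on_comparison_test) (auto intro!: mult_left_mono power_mono)
  show "(\<lambda>j. complex_of_real (M i j) * x j) summable_on UNIV"
    by (rule abs_summable_summable) (use 1 in \<open>simp add: norm_mult\<close>)
qed

lemma linear_map_matrix_op:
  fixes M :: "'i \<Rightarrow> 'i \<Rightarrow> real"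
  assumes "\<And>i x. x \<in> vecs l2 \<Longrightarrow> (\<lambda>j. complex_of_real (M i j) * x j) summable_on UNIV"
    and "\<And>x. x \<in> vecs l2 \<Longrightarrow> matrix_op M x \<in> vecs l2"
  shows "linear_map l2 l2 (matrix_op M)"
  unfolding linear_map_def
proof (intro conjI ballI allI)
  show "matrix_op M ` vecs l2 \<subseteq> vecs l2"
    using assms(2) by blast
  fix x :: "'i \<Rightarrow> complex" assume x: "x \<in> vecs l2"
  show "matrix_op M (x + y) = matrix_op M x + matrix_op M y" if y: "y \<in> vecs l2" for y
    using infsum_add[OF assms(1)[OF x] assms(1)[OF y]]
    by (simp add: matrix_op_def fun_eq_iff distrib_left)
  show "matrix_op M (scl l2 c x) = scl l2 c (matrix_op M x)" for c
    by (simp add: matrix_op_def fun_eq_iff mult.left_commute infsum_cmult_right')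
qed

text \<open>The weighted Cauchy--Schwarz inequality for one row is the nonnegativity of
  \<open>\<Sum>j. \<bar>M i j\<bar> (\<bar>x j\<bar> - S / A)\<^sup>2\<close>, where \<open>S = \<Sum>j. \<bar>M i j\<bar> \<bar>x j\<bar>\<close>.\<close>

lemma Schur_test:
  fixes M :: "'i \<Rightarrow> 'i \<Rightarrow> real"
  assumes sym: "\<And>i j. \<bar>M i j\<bar> = \<bar>M j i\<bar>"
    and row: "\<And>i. (\<lambda>j. \<bar>M i j\<bar>) summable_on UNIV" "\<And>i. (\<Sum>\<^sub>\<infinity>j. \<bar>M i j\<bar>) \<le> A"
    and A: "A > 0"
  shows "bounded_operator l2 (matrix_op M)"
proof -
  have bound: "matrix_op M x \<in> vecs l2 \<and> hnorm l2 (matrix_op M x) \<le> A * hnorm l2 x"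
    if x: "x \<in> vecs l2" for x
  proof -
    note s = l2_abs_row_summable[of M _ x, OF row(1) x]
    define Q where "Q i = (\<Sum>\<^sub>\<infinity>j. \<bar>M i j\<bar> * (cmod (x j))\<^sup>2)" for i
    have le: "(cmod (matrix_op M x i))\<^sup>2 \<le> A * Q i" for i
    proof -
      define S where "S = (\<Sum>\<^sub>\<infinity>j. \<bar>M i j\<bar> * cmod (x j))"
      define a where "a = (\<Sum>\<^sub>\<infinity>j. \<bar>M i j\<bar>)"
      \<comment> \<open>The shift is \<open>S / A\<close> and not the minimising
        \<open>S / a\<close>: the row sum \<open>a\<close> may be 0, and \<open>a \<le> A\<close> is
        enough to reach \<open>Q i - S\<^sup>2 / A\<close>.\<close>
      have "0 \<le> (\<Sum>\<^sub>\<infinity>j. \<bar>M i j\<bar> * (cmod (x j) - S / A)\<^sup>2)"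
        by (intro infsum_nonneg) auto
      also have "((\<lambda>j. \<bar>M i j\<bar> * (cmod (x j) - S / A)\<^sup>2) has_sum
          (Q i + (S / A)\<^sup>2 * a + (- 2 * (S / A)) * S)) UNIV"
      proof -
        have "((\<lambda>j. \<bar>M i j\<bar> * (cmod (x j))\<^sup>2 + (S / A)\<^sup>2 * \<bar>M i j\<bar>
            + (- 2 * (S / A)) * (\<bar>M i j\<bar> * cmod (x j))) has_sum
            (Q i + (S / A)\<^sup>2 * a + (- 2 * (S / A)) * S)) UNIV"
          unfolding Q_def a_def S_def
          by (intro has_sum_add has_sum_cmult_right has_sum_infsum s row(1))
        then show ?thesis
          by (simp add: power2_diff algebra_simps)
      qed
      then have "(\<Sum>\<^sub>\<infinity>j. \<bar>M i j\<bar> * (cmod (x j) - S / A)\<^sup>2) = Q i + (S / A)\<^sup>2 * a + (- 2 * (S / A)) * S"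
        by (rule infsumI)
      also have "(S / A)\<^sup>2 * a \<le> (S / A)\<^sup>2 * A"
        using row(2) by (intro mult_left_mono) (auto simp: a_def)
      finally have "0 \<le> Q i - S\<^sup>2 / A"
        using A by (simp add: field_simps power2_eq_square)
      then have "S\<^sup>2 \<le> A * Q i"
        using A by (simp add: field_simps)
      moreover have "cmod (matrix_op M x i) \<le> S"
        using norm_infsum_bound[of "\<lambda>j. complex_of_real (M i j) * x j" UNIV] s(1)[of i]
        by (simp add: matrix_op_def S_def norm_mult)
      then have "(cmod (matrix_op M x i))\<^sup>2 \<le> S\<^sup>2"
        by (intro power_mono) auto
      ultimately show ?thesis
        by linarith
    qed
    \<comment> \<open>By the symmetry of the absolute values, column sums are row sums and obey the
      same bound \<open>A\<close>.\<close>
    have col: "((\<lambda>i. \<bar>M i j\<bar> * (cmod (x j))\<^sup>2) has_sum (\<Sum>\<^sub>\<infinity>i. \<bar>M j i\<bar>) * (cmod (x j))\<^sup>2) UNIV" for j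
      using row(1)[of j] sym by (intro has_sum_cmult_left) auto
    have col_le: "(\<Sum>\<^sub>\<infinity>i. \<bar>M j i\<bar>) * (cmod (x j))\<^sup>2 \<le> A * (cmod (x j))\<^sup>2" for j
      using row(2) by (intro mult_right_mono) auto
    have xs: "(\<lambda>j. A * (cmod (x j))\<^sup>2) summable_on UNIV"
      using x by (intro summable_on_cmult_right) auto
    have cols: "(\<lambda>j. (\<Sum>\<^sub>\<infinity>i. \<bar>M j i\<bar>) * (cmod (x j))\<^sup>2) summable_on UNIV"
      using xs by (rule summable_on_comparison_test) (auto simp: col_le infsum_nonneg)
    \<comment> \<open>Tonelli: the double series converges when summed over \<open>i\<close> first,
      so the order of summation may be exchanged.\<close>
    have dbl: "(\<lambda>(j, i). \<bar>M i j\<bar> * (cmod (x j))\<^sup>2) summable_on UNIV \<times> UNIV"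
      by (rule summable_on_SigmaI[OF _ cols]) (use col in auto)
    have dbl': "(\<lambda>(i, j). \<bar>M i j\<bar> * (cmod (x j))\<^sup>2) summable_on UNIV \<times> UNIV"
      using dbl summable_on_reindex_bij_betw[of prod.swap "UNIV \<times> UNIV" "UNIV \<times> UNIV"
          "\<lambda>(j, i). \<bar>M i j\<bar> * (cmod (x j))\<^sup>2"]
      by (auto simp: case_prod_unfold)
    have Qs: "Q summable_on UNIV"
      unfolding Q_def using summable_on_Sigma_banach[OF dbl'] by simp
    have "(\<Sum>\<^sub>\<infinity>i. Q i) = (\<Sum>\<^sub>\<infinity>j. \<Sum>\<^sub>\<infinity>i. \<bar>M i j\<bar> * (cmod (x j))\<^sup>2)"
      unfolding Q_def by (rule infsum_swap_banach[OF dbl'])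
    also have "\<dots> = (\<Sum>\<^sub>\<infinity>j. (\<Sum>\<^sub>\<infinity>i. \<bar>M j i\<bar>) * (cmod (x j))\<^sup>2)"
      using infsumI[OF col] by simp
    also have "\<dots> \<le> (\<Sum>\<^sub>\<infinity>j. A * (cmod (x j))\<^sup>2)"
      using cols xs col_le by (rule infsum_mono)
    also have "\<dots> = A * (hnorm l2 x)\<^sup>2"
      by (simp add: infsum_cmult_right' l2_hnorm_sq)
    finally have Q_le: "(\<Sum>\<^sub>\<infinity>i. Q i) \<le> A * (hnorm l2 x)\<^sup>2" .
    have "(\<Sum>i\<in>F. (cmod (matrix_op M x i))\<^sup>2) \<le> (A * hnorm l2 x)\<^sup>2" if "finite F" for F
    proof -
      have "(\<Sum>i\<in>F. (cmod (matrix_op M x i))\<^sup>2) \<le> (\<Sum>i\<in>F. A * Q i)"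
        by (intro sum_mono le)
      also have "\<dots> = A * (\<Sum>i\<in>F. Q i)"
        by (simp add: sum_distrib_left)
      also have "\<dots> \<le> A * (\<Sum>\<^sub>\<infinity>i. Q i)"
        using A that by (intro mult_left_mono finite_sum_le_infsum Qs) (auto simp: Q_def infsum_nonneg)
      also have "\<dots> \<le> A * (A * (hnorm l2 x)\<^sup>2)"
        using A Q_le by (intro mult_left_mono) auto
      finally show ?thesis
        by (simp add: power2_eq_square mult_ac)
    qed
    then show ?thesis
      using l2_of_bounded_sums[of "matrix_op M x" "A * hnorm l2 x"] A by simp
  qed
  have "linear_map l2 l2 (matrix_op M)"
    by (intro linear_map_matrix_op l2_abs_row_summable(3)[of M, OF row(1)] conjunct1[OF bound])
  with bound show ?thesis
    unfolding bounded_operator_def by blast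
qed

text \<open>The series of \<open>(1 - z) powr (- j - 1)\<close> at \<open>z = 1 / 2\<close> has sum
  \<open>2 ^ (j + 1)\<close>, and the remaining factor \<open>(1 / 2) ^ j\<close> makes the value
  independent of \<open>j\<close>.\<close>

lemma choose_half_has_sum:
  "((\<lambda>k. real ((j + k) choose j) * (1 / 2) ^ (j + k)) has_sum 2) UNIV"
proof (rule sums_nonneg_imp_has_sum)
  \<comment> \<open>Negating the upper index produces the sign \<open>(- 1) ^ k\<close>, which
    cancels the sign of the argument \<open>- (1 / 2)\<close>.\<close>
  have eq: "((- real j - 1) gchoose k) * (- (1 / 2)) ^ k = real ((j + k) choose j) * (1 / 2) ^ k" for k
  proof -
    have "(- real j - 1) gchoose k = (- 1) ^ k * real ((j + k) choose k)"
      by (subst gbinomial_negated_upper) (simp add: binomial_gbinomial add.commute)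
    then show ?thesis
      using binomial_symmetric[of k "j + k"]
      by (simp add: power_mult_distrib[symmetric] mult.assoc mult.left_commute)
  qed
  have "(\<lambda>k. ((- real j - 1) gchoose k) * (- (1 / 2)) ^ k) sums (1 + - (1 / 2)) powr (- real j - 1)"
    by (rule gen_binomial_real) simp
  then have "(\<lambda>k. (1 / 2) ^ j * (real ((j + k) choose j) * (1 / 2) ^ k)) sums
      ((1 / 2) ^ j * (1 / 2) powr (- real j - 1))"
    unfolding eq by (intro sums_mult) simp
  moreover have "(1 / 2 :: real) ^ j * (1 / 2) powr (- real j - 1) = 2"
    by (simp add: powr_diff powr_minus powr_realpow field_simps)
  ultimately show "(\<lambda>k. real ((j + k) choose j) * (1 / 2) ^ (j + k)) sums 2"
    by (simp add: power_add mult.left_commute)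
qed simp

section \<open>The isometry given by a unit vector on each fibre\<close>

text \<open>The fibres partition the index set, so \<open>snd\<close> is a bijection from the
  disjoint union of the fibres and the sum can be taken fibre by fibre.\<close>

lemma has_sum_fibres:
  fixes f :: "'i \<Rightarrow> 'a :: {topological_comm_monoid_add,t3_space}" and p :: "'i \<Rightarrow> 'n"
  assumes f: "(f has_sum S) UNIV" and fin: "\<And>n. finite {i. p i = n}"
  shows "((\<lambda>n. \<Sum>i | p i = n. f i) has_sum S) UNIV"
proof (rule has_sum_SigmaD[where B = "\<lambda>n. {i. p i = n}" and f = "\<lambda>(n, i). f i"])
  have "bij_betw snd (SIGMA n:UNIV. {i. p i = n}) UNIV"
    by (auto simp: bij_betw_def inj_on_def image_iff)
  from has_sum_reindex_bij_betw[OF this, of f] f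
  show "((\<lambda>(n, i). f i) has_sum S) (SIGMA n:UNIV. {i. p i = n})"
    by (simp add: case_prod_unfold)
  show "((\<lambda>i. case (n, i) of (n, i) \<Rightarrow> f i) has_sum (\<Sum>i | p i = n. f i)) {i. p i = n}" for n
    using fin by simp
qed

text \<open>The converse direction of the regrouping, where nonnegativity excludes cancellation
  inside a fibre.\<close>

lemma summable_on_fibres:
  fixes f :: "'i \<Rightarrow> real" and p :: "'i \<Rightarrow> 'n"
  assumes "(\<lambda>n. \<Sum>i | p i = n. f i) summable_on UNIV" "\<And>n. finite {i. p i = n}" "\<And>i. 0 \<le> f i"
  shows "f summable_on UNIV"
proof -
  have "(\<lambda>(n, i). f i) summable_on (SIGMA n:UNIV. {i. p i = n})"
    by (rule summable_on_SigmaI[OF _ assms(1)]) (use assms in auto)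
  moreover have "bij_betw snd (SIGMA n:UNIV. {i. p i = n}) UNIV"
    by (auto simp: bij_betw_def inj_on_def image_iff)
  from summable_on_reindex_bij_betw[OF this, of f]
  have "(\<lambda>(n, i). f i) summable_on (SIGMA n:UNIV. {i. p i = n}) \<longleftrightarrow> f summable_on UNIV"
    by (simp add: case_prod_unfold)
  ultimately show ?thesis
    by simp
qed

text \<open>In the application the fibres of \<open>p\<close> are the shells. The restrictions of
  \<open>v\<close> to the fibres have disjoint supports, so they form an orthonormal family indexed
  by \<open>'n\<close>.\<close>

locale fibre_vectors =
  fixes p :: "'i \<Rightarrow> 'n" and v :: "'i \<Rightarrow> real"
  assumes fin: "\<And>n. finite {i. p i = n}"
    and unit: "\<And>n. (\<Sum>i | p i = n. (v i)\<^sup>2) = 1"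
begin

text \<open>The isometry V of the overview: the \<open>n\<close>-th unit vector goes to the
  restriction of \<open>v\<close> to the fibre over \<open>n\<close>.\<close>

definition emb :: "('n \<Rightarrow> complex) \<Rightarrow> 'i \<Rightarrow> complex" where
  "emb y i = complex_of_real (v i) * y (p i)"

text \<open>The adjoint V* of \<open>emb\<close>. Its coordinates are finite sums, so no convergence
  question arises.\<close>

definition coemb :: "('i \<Rightarrow> complex) \<Rightarrow> 'n \<Rightarrow> complex" where
  "coemb x n = (\<Sum>i | p i = n. complex_of_real (v i) * x i)"

text \<open>The orthogonal complement of the range of \<open>emb\<close>, on which the zero summand
  acts. It is trivial when every fibre is a single point.\<close>

definition coemb_kernel :: "('i \<Rightarrow> complex) cspace" where
  "coemb_kernel = l2\<lparr>vecs := {x \<in> vecs l2. coemb x = 0}\<rparr>"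

lemma coemb_emb [simp]: "coemb (emb y) = y"
proof
  fix n
  have "coemb (emb y) n = (\<Sum>i | p i = n. complex_of_real ((v i)\<^sup>2) * y n)"
    unfolding coemb_def emb_def by (intro sum.cong) (auto simp: power2_eq_square)
  also have "\<dots> = y n"
    by (simp add: sum_distrib_right[symmetric] unit flip: of_real_sum of_real_power)
  finally show "coemb (emb y) n = y n" .
qed

lemma emb_add: "emb (x + y) = emb x + emb y"
  and emb_scale: "emb (\<lambda>n. c * y n) = (\<lambda>i. c * emb y i)"
  by (auto simp: emb_def fun_eq_iff algebra_simps)

lemma coemb_add: "coemb (x + y) = coemb x + coemb y"
  and coemb_diff: "coemb (x - y) = coemb x - coemb y"
  and coemb_scale: "coemb (\<lambda>i. c * x i) = (\<lambda>n. c * coemb x n)"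
  by (auto simp: coemb_def fun_eq_iff algebra_simps sum.distrib sum_subtractf sum_distrib_left)

text \<open>Cauchy-Schwarz on one fibre, with \<open>v\<close> of norm 1 there. The absolute values
  make it serve both the norm bound for \<open>coemb\<close> and absolute convergence in
  \<open>matrix_op_emb\<close>.\<close>

lemma fibre_abs_sum_le:
  "(\<Sum>i | p i = n. \<bar>v i\<bar> * cmod (x i))\<^sup>2 \<le> (\<Sum>i | p i = n. (cmod (x i))\<^sup>2)"
  using Cauchy_Schwarz_ineq_sum[of "\<lambda>i. \<bar>v i\<bar>" "\<lambda>i. cmod (x i)" "{i. p i = n}"] unit by simp

lemma coemb_le: "cmod (coemb x n) \<le> (\<Sum>i | p i = n. \<bar>v i\<bar> * cmod (x i))"
  unfolding coemb_def by (rule order_trans[OF norm_sum]) (simp add: norm_mult)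

lemma coemb_l2:
  assumes x: "x \<in> vecs l2"
  shows "coemb x \<in> vecs l2" "hnorm l2 (coemb x) \<le> hnorm l2 x"
proof -
  have "(\<Sum>n\<in>F. (cmod (coemb x n))\<^sup>2) \<le> (hnorm l2 x)\<^sup>2" if "finite F" for F
  proof -
    have "(\<Sum>n\<in>F. (cmod (coemb x n))\<^sup>2) \<le> (\<Sum>n\<in>F. \<Sum>i | p i = n. (cmod (x i))\<^sup>2)"
      using coemb_le fibre_abs_sum_le by (intro sum_mono) (meson norm_ge_zero order_trans power_mono)
    also have "\<dots> = (\<Sum>i\<in>(\<Union>n\<in>F. {i. p i = n}). (cmod (x i))\<^sup>2)"
      using that fin by (subst sum.UNION_disjoint) auto
    also have "\<dots> \<le> (hnorm l2 x)\<^sup>2"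
      using x that fin by (intro l2_sum_le_hnorm) auto
    finally show ?thesis .
  qed
  then show "coemb x \<in> vecs l2" "hnorm l2 (coemb x) \<le> hnorm l2 x"
    using l2_of_bounded_sums[of "coemb x" "hnorm l2 x"] by auto
qed

lemma emb_l2:
  assumes y: "y \<in> vecs l2"
  shows "emb y \<in> vecs l2"
proof -
  have "(\<Sum>i | p i = n. (cmod (emb y i))\<^sup>2) = (cmod (y n))\<^sup>2" for n
  proof -
    have "(\<Sum>i | p i = n. (cmod (emb y i))\<^sup>2) = (\<Sum>i | p i = n. (v i)\<^sup>2 * (cmod (y n))\<^sup>2)"
      by (intro sum.cong) (auto simp: emb_def norm_mult power_mult_distrib)
    then show ?thesis
      by (simp add: sum_distrib_right[symmetric] unit)
  qed
  then have "(\<lambda>i. (cmod (emb y i))\<^sup>2) summable_on UNIV"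
    using y by (intro summable_on_fibres[OF _ fin]) auto
  then show ?thesis
    by simp
qed

lemma emb_adjoint:
  assumes y: "y \<in> vecs l2" and x: "x \<in> vecs l2"
  shows "ip l2 (emb y) x = ip l2 y (coemb x)"
proof -
  have "((\<lambda>n. \<Sum>i | p i = n. emb y i * cnj (x i)) has_sum ip l2 (emb y) x) UNIV"
    using l2_ip_summable[OF emb_l2[OF y] x] by (intro has_sum_fibres fin) simp
  also have "(\<lambda>n. \<Sum>i | p i = n. emb y i * cnj (x i)) = (\<lambda>n. y n * cnj (coemb x n))"
    by (auto simp: emb_def coemb_def sum_distrib_left fun_eq_iff mult_ac intro!: sum.cong)
  finally have "(\<Sum>\<^sub>\<infinity>n. y n * cnj (coemb x n)) = ip l2 (emb y) x"
    by (rule infsumI)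
  then show ?thesis
    by simp
qed

lemma emb_adjoint':
  assumes "y \<in> vecs l2" "x \<in> vecs l2"
  shows "ip l2 x (emb y) = ip l2 (coemb x) y"
  using emb_adjoint[OF assms] l2_ip_cnj by metis

lemma hnorm_emb:
  assumes "y \<in> vecs l2"
  shows "hnorm l2 (emb y) = hnorm l2 y"
  using emb_adjoint[OF assms emb_l2[OF assms]] by (simp add: hnorm_def)

text \<open>Each coordinate of \<open>coemb x\<close> depends on finitely many coordinates of
  \<open>x\<close>, so its vanishing survives pointwise limits.\<close>

lemma hilbert_space_coemb_kernel: "hilbert_space coemb_kernel"
  unfolding coemb_kernel_def
proof (rule hilbert_space_l2_subspace)
  fix X :: "nat \<Rightarrow> 'i \<Rightarrow> complex" and x
  assume X: "\<And>n. X n \<in> {x \<in> vecs l2. coemb x = 0}" and x: "x \<in> vecs l2"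
    and lim: "\<And>i. (\<lambda>n. X n i) \<longlonglongrightarrow> x i"
  have "coemb x m = 0" for m
  proof (rule LIMSEQ_unique)
    show "(\<lambda>n. coemb (X n) m) \<longlonglongrightarrow> coemb x m"
      unfolding coemb_def by (intro tendsto_intros lim)
    show "(\<lambda>n. coemb (X n) m) \<longlonglongrightarrow> 0"
      using X by simp
  qed
  with x show "x \<in> {x \<in> vecs l2. coemb x = 0}"
    by (simp add: fun_eq_iff)
next
  show "0 \<in> {x \<in> vecs l2. coemb x = 0}"
    using l2_zero by (simp add: coemb_def fun_eq_iff)
qed (use l2_add l2_scale in \<open>auto simp: coemb_add coemb_scale fun_eq_iff simp del: l2_simps\<close>)

theorem unitarily_equivalent_direct_sum_zero:
  assumes T: "\<And>x. x \<in> vecs l2 \<Longrightarrow> T x = emb (B (coemb x))" and B: "bounded_operator l2 B"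
  shows "unitarily_equivalent l2 T (direct_sum l2 coemb_kernel) (direct_sum_op B zero_op)"
proof -
  define U where "U x = (coemb x, x - emb (coemb x))" for x
  let ?W = "direct_sum l2 coemb_kernel :: (('n \<Rightarrow> complex) \<times> ('i \<Rightarrow> complex)) cspace"
  have vecs_W: "vecs ?W = vecs l2 \<times> {x \<in> vecs l2. coemb x = 0}"
    by (simp add: direct_sum_def coemb_kernel_def del: l2_simps)
  have scl_W: "scl ?W c w = (\<lambda>n. c * fst w n, \<lambda>i. c * snd w i)" for c w
    by (simp add: direct_sum_def coemb_kernel_def case_prod_unfold)
  have ip_W: "ip ?W w w' = ip l2 (fst w) (fst w') + ip l2 (snd w) (snd w')" for w w'
    by (simp add: direct_sum_def coemb_kernel_def case_prod_unfold del: l2_simps)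
  obtain C where lin: "linear_map l2 l2 B"
    and C: "\<And>y. y \<in> vecs l2 \<Longrightarrow> hnorm l2 (B y) \<le> C * hnorm l2 y"
    using B by (auto simp: bounded_operator_def simp del: l2_simps)
  have B_l2: "B y \<in> vecs l2" if "y \<in> vecs l2" for y
    using lin that by (auto simp: linear_map_def simp del: l2_simps)
  have B_add: "B (x + y) = B x + B y" if "x \<in> vecs l2" "y \<in> vecs l2" for x y
    using lin that by (auto simp: linear_map_def simp del: l2_simps)
  have B_scale: "B (\<lambda>n. c * y n) = (\<lambda>n. c * B y n)" if "y \<in> vecs l2" for c y
    using lin that by (auto simp: linear_map_def)
  \<comment> \<open>Boundedness does not fix the sign of \<open>C\<close>; a nonnegative constant is
    needed to multiply norm inequalities by it.\<close>
  have C0: "hnorm l2 (B y) \<le> \<bar>C\<bar> * hnorm l2 y" if "y \<in> vecs l2" for y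
    using C[OF that] by (smt (verit) hnorm_l2_nonneg mult_right_mono)

  have "bounded_operator l2 T"
    unfolding bounded_operator_def linear_map_def
  proof (intro conjI exI ballI allI)
    show "T ` vecs l2 \<subseteq> vecs l2"
      using T B_l2 emb_l2 coemb_l2(1) by (auto simp del: l2_simps)
    fix x :: "'i \<Rightarrow> complex" assume x: "x \<in> vecs l2"
    show "T (x + y) = T x + T y" if y: "y \<in> vecs l2" for y
      using x y l2_add[OF x y] coemb_l2(1) by (simp add: T coemb_add B_add emb_add del: l2_simps)
    show "T (scl l2 c x) = scl l2 c (T x)" for c
      using x l2_scale[OF x] coemb_l2(1)
      by (simp add: T coemb_scale B_scale emb_scale del: l2_simps(1,3))
    have "hnorm l2 (T x) \<le> \<bar>C\<bar> * hnorm l2 (coemb x)"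
      using C0[OF coemb_l2(1)[OF x]] hnorm_emb[OF B_l2[OF coemb_l2(1)[OF x]]] by (simp add: T[OF x])
    also have "\<dots> \<le> \<bar>C\<bar> * hnorm l2 x"
      using coemb_l2(2)[OF x] by (intro mult_left_mono) auto
    finally show "hnorm l2 (T x) \<le> \<bar>C\<bar> * hnorm l2 x" .
  qed
  moreover have "bounded_operator ?W (direct_sum_op B zero_op)"
    unfolding bounded_operator_def linear_map_def
  proof (intro conjI exI ballI allI)
    show "direct_sum_op B zero_op ` vecs ?W \<subseteq> vecs ?W"
      using B_l2 l2_zero
      by (auto simp: vecs_W direct_sum_op_def zero_op_def coemb_def fun_eq_iff simp del: l2_simps)
    fix w assume w: "w \<in> vecs ?W"
    show "direct_sum_op B zero_op (w + w') = direct_sum_op B zero_op w + direct_sum_op B zero_op w'"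
      if "w' \<in> vecs ?W" for w'
      using w that
      by (auto simp: vecs_W direct_sum_op_def zero_op_def B_add prod_eq_iff simp del: l2_simps)
    show "direct_sum_op B zero_op (scl ?W c w) = scl ?W c (direct_sum_op B zero_op w)" for c
      using w
      by (auto simp: vecs_W scl_W direct_sum_op_def zero_op_def B_scale prod_eq_iff fun_eq_iff
          simp del: l2_simps)
    have "hnorm ?W (direct_sum_op B zero_op w) = hnorm l2 (B (fst w))"
      by (simp add: hnorm_def ip_W direct_sum_op_def zero_op_def)
    also have "\<dots> \<le> \<bar>C\<bar> * hnorm l2 (fst w)"
      using w by (intro C0) (auto simp: vecs_W simp del: l2_simps)
    also have "\<dots> \<le> \<bar>C\<bar> * hnorm ?W w"
      unfolding hnorm_def ip_W
      by (intro mult_left_mono real_sqrt_le_mono)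
        (auto simp: l2_ip_self infsum_nonneg simp del: l2_simps)
    finally show "hnorm ?W (direct_sum_op B zero_op w) \<le> \<bar>C\<bar> * hnorm ?W w" .
  qed
  moreover have "unitary l2 ?W U"
    unfolding unitary_def linear_map_def
  proof (intro conjI ballI allI)
    show U_l2: "U ` vecs l2 \<subseteq> vecs ?W"
      using coemb_l2(1) emb_l2 l2_diff
      by (auto simp: U_def vecs_W coemb_diff simp del: l2_simps)
    have "emb y + k \<in> vecs l2" if "(y, k) \<in> vecs ?W" for y k
      using that l2_add emb_l2 by (auto simp: vecs_W simp del: l2_simps)
    \<comment> \<open>The inverse adds the two components back. Applying V* to
      \<open>emb y + k\<close> returns \<open>y\<close>, since V* V is the identity and V* kills
      \<open>k\<close>.\<close>
    then show "bij_betw U (vecs l2) (vecs ?W)"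
      using U_l2
      by (intro bij_betw_byWitness[where f' = "\<lambda>(y, k). emb y + k"])
        (auto simp: U_def vecs_W coemb_add simp del: l2_simps)
    fix x :: "'i \<Rightarrow> complex" assume x: "x \<in> vecs l2"
    show "U (scl l2 c x) = scl ?W c (U x)" for c
      by (simp add: U_def scl_W coemb_scale emb_scale fun_eq_iff algebra_simps)
    fix y :: "'i \<Rightarrow> complex" assume y: "y \<in> vecs l2"
    show "U (x + y) = U x + U y"
      by (simp add: U_def coemb_add emb_add)
    note l = x y coemb_l2(1)[OF x] coemb_l2(1)[OF y]
    note l' = l emb_l2[OF l(3)] emb_l2[OF l(4)]
    \<comment> \<open>V V* is an orthogonal projection: after moving \<open>emb\<close> across, the
      three correction terms are the inner product of \<open>coemb x\<close> and
      \<open>coemb y\<close> with signs -, -, +.\<close>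
    have "ip l2 (x - emb (coemb x)) (y - emb (coemb y)) = ip l2 x y - ip l2 (coemb x) (coemb y)"
      using l' l2_diff[OF l'(2,6)]
      by (simp add: l2_ip_diff_left l2_ip_diff_right emb_adjoint emb_adjoint' del: l2_simps)
    then show "ip ?W (U x) (U y) = ip l2 x y"
      by (simp add: ip_W U_def del: l2_simps)
  qed
  moreover have "U (T x) = direct_sum_op B zero_op (U x)" if "x \<in> vecs l2" for x
    using that by (simp add: U_def T direct_sum_op_def zero_op_def del: l2_simps)
  ultimately show ?thesis
    unfolding unitarily_equivalent_def unitarily_equivalent_by_def by blast
qed

text \<open>Identifies the factorisation V B V* from matrix entries: summing a row over a fibre
  first turns \<open>x\<close> into \<open>coemb x\<close>.\<close>

lemma matrix_op_emb:
  fixes B :: "'n \<Rightarrow> 'n \<Rightarrow> real"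
  assumes row: "\<And>n. (\<lambda>m. \<bar>B n m\<bar>) summable_on UNIV" and x: "x \<in> vecs l2"
  shows "matrix_op (\<lambda>i j. v i * v j * B (p i) (p j)) x = emb (matrix_op B (coemb x))"
proof
  fix i
  let ?f = "\<lambda>j. complex_of_real (v i * v j * B (p i) (p j)) * x j"
  \<comment> \<open>Regrouping requires convergence beforehand. Each fibre contributes at most a
    constant multiple of the entry of \<open>B\<close>, because the fibre sum of
    \<open>\<bar>v j\<bar> * cmod (x j)\<close> is at most the norm of \<open>x\<close>.\<close>
  have "(\<lambda>j. cmod (?f j)) summable_on UNIV"
  proof (rule summable_on_fibres[OF _ fin])
    show "(\<lambda>n. \<Sum>j | p j = n. cmod (?f j)) summable_on UNIV"
    proof (rule summable_on_comparison_test)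
      show "(\<lambda>n. \<bar>v i\<bar> * (\<bar>B (p i) n\<bar> * hnorm l2 x)) summable_on UNIV"
        using row by (intro summable_on_cmult_right summable_on_cmult_left)
      fix n
      have "(\<Sum>j | p j = n. cmod (?f j)) = \<bar>v i\<bar> * (\<bar>B (p i) n\<bar> * (\<Sum>j | p j = n. \<bar>v j\<bar> * cmod (x j)))"
        unfolding sum_distrib_left by (intro sum.cong) (auto simp: norm_mult abs_mult)
      moreover have "(\<Sum>j | p j = n. \<bar>v j\<bar> * cmod (x j)) \<le> hnorm l2 x"
        using order_trans[OF fibre_abs_sum_le l2_sum_le_hnorm[OF x fin]]
        by (rule power2_le_imp_le) simp
      ultimately show "(\<Sum>j | p j = n. cmod (?f j)) \<le> \<bar>v i\<bar> * (\<bar>B (p i) n\<bar> * hnorm l2 x)"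
        by (simp add: mult_left_mono)
    qed (simp add: sum_nonneg)
  qed simp
  then have "?f summable_on UNIV"
    by (rule abs_summable_summable)
  then have "((\<lambda>n. \<Sum>j | p j = n. ?f j) has_sum matrix_op (\<lambda>i j. v i * v j * B (p i) (p j)) x i) UNIV"
    unfolding matrix_op_def by (intro has_sum_fibres fin has_sum_infsum)
  also have "(\<lambda>n. \<Sum>j | p j = n. ?f j) =
      (\<lambda>n. complex_of_real (v i) * (complex_of_real (B (p i) n) * coemb x n))"
    by (auto simp: coemb_def sum_distrib_left fun_eq_iff mult_ac intro!: sum.cong)
  finally show "matrix_op (\<lambda>i j. v i * v j * B (p i) (p j)) x i = emb (matrix_op B (coemb x)) i"
    by (auto dest: infsumI simp: emb_def matrix_op_def infsum_cmult_right')
qed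

end

section \<open>Multi-indices and the coefficients\<close>

text \<open>The terms in the multinomial expansion of the \<open>N\<close>-th power of the
  coordinate sum, divided by \<open>N!\<close>.\<close>

definition mi_weight :: "real ^ 'd \<Rightarrow> nat ^ 'd \<Rightarrow> real" where
  "mi_weight x \<alpha> = (\<Prod>j\<in>UNIV. x $ j ^ (\<alpha> $ j)) / mi_fact \<alpha>"

lemma finite_mi_size: "finite {\<alpha> :: nat ^ 'd. mi_size \<alpha> = N}"
proof (rule finite_subset)
  show "finite (vec_lambda ` (UNIV \<rightarrow>\<^sub>E {..N}) :: (nat ^ 'd) set)"
    by (intro finite_imageI finite_PiE) auto
  show "{\<alpha> :: nat ^ 'd. mi_size \<alpha> = N} \<subseteq> vec_lambda ` (UNIV \<rightarrow>\<^sub>E {..N})"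
  proof
    fix \<alpha> :: "nat ^ 'd" assume "\<alpha> \<in> {\<alpha>. mi_size \<alpha> = N}"
    then have "\<alpha> $ j \<le> N" for j
      using member_le_sum[of j UNIV "\<lambda>j. \<alpha> $ j"] by (simp add: mi_size_def)
    then show "\<alpha> \<in> vec_lambda ` (UNIV \<rightarrow>\<^sub>E {..N})"
      by (intro image_eqI[of _ _ "vec_nth \<alpha>"]) auto
  qed
qed

lemma mi_size_add: "mi_size (\<alpha> + \<beta>) = mi_size \<alpha> + mi_size \<beta>"
  by (simp add: mi_size_def sum.distrib)

lemma mi_size_axis [simp]: "mi_size (axis j n) = n"
  by (simp add: mi_size_def axis_def)

text \<open>One more unit at \<open>j\<close> multiplies the monomial by \<open>x $ j\<close> and
  the factorial by the new \<open>j\<close>-th exponent, which the factor on the left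
  cancels.\<close>

lemma mi_weight_add_axis:
  "real ((\<beta> + axis j 1) $ j) * mi_weight x (\<beta> + axis j 1) = x $ j * mi_weight x \<beta>"
proof -
  have same: "(\<beta> + axis j 1) $ i = \<beta> $ i" if "i \<in> UNIV - {j}" for i
    using that by (simp add: axis_def)
  have 2: "(\<beta> + axis j 1) $ j = Suc (\<beta> $ j)"
    by simp
  note split = prod.remove[OF finite UNIV_I, of _ j]
  have "(\<Prod>i\<in>UNIV - {j}. x $ i ^ ((\<beta> + axis j 1) $ i)) = (\<Prod>i\<in>UNIV - {j}. x $ i ^ (\<beta> $ i))"
    by (intro prod.cong refl arg_cong2[of _ _ _ _ "(^)"] same)
  then have num: "(\<Prod>i\<in>UNIV. x $ i ^ ((\<beta> + axis j 1) $ i)) = x $ j * (\<Prod>i\<in>UNIV. x $ i ^ (\<beta> $ i))"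
    unfolding split 2 by simp
  have "(\<Prod>i\<in>UNIV - {j}. fact ((\<beta> + axis j 1) $ i)) = (\<Prod>i\<in>UNIV - {j}. fact (\<beta> $ i) :: real)"
    by (intro prod.cong refl arg_cong[of _ _ fact] same)
  then have den: "mi_fact (\<beta> + axis j 1) = real (Suc (\<beta> $ j)) * mi_fact \<beta>"
    unfolding mi_fact_def split 2 by simp
  show ?thesis
    unfolding mi_weight_def num den 2 by simp
qed

text \<open>Induction on \<open>N\<close>: write \<open>Suc N\<close> as \<open>\<Sum>j. \<alpha> $ j\<close> and remove one unit of \<open>\<alpha>\<close> at \<open>j\<close>.\<close>

lemma sum_mi_weight:
  fixes x :: "real ^ 'd"
  shows "(\<Sum>\<alpha> | mi_size \<alpha> = N. mi_weight x \<alpha>) = (\<Sum>j\<in>UNIV. x $ j) ^ N / fact N"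
proof (induction N)
  case 0
  have "{\<alpha> :: nat ^ 'd. mi_size \<alpha> = 0} = {0}"
    by (auto simp: mi_size_def vec_eq_iff)
  then show ?case
    by (simp add: mi_weight_def mi_fact_def)
next
  case (Suc N)
  have shift: "(\<Sum>\<alpha> | mi_size \<alpha> = Suc N. real (\<alpha> $ j) * mi_weight x \<alpha>)
      = (\<Sum>\<beta> | mi_size \<beta> = N. x $ j * mi_weight x \<beta>)" for j
  \<comment> \<open>Multi-indices with \<open>\<alpha> $ j = 0\<close> contribute 0 through the
    factor \<open>\<alpha> $ j\<close>; on the others the truncated subtraction of
    \<open>axis j 1\<close> is exact and inverts the shift.\<close>
  proof (rule sym, rule sum.reindex_bij_witness_not_neutral[where
        S' = "{}" and T' = "{\<alpha>. mi_size \<alpha> = Suc N \<and> \<alpha> $ j = 0}"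
        and i = "\<lambda>\<alpha>. \<alpha> - axis j 1" and j = "\<lambda>\<beta>. \<beta> + axis j 1"])
    have minus: "\<alpha> - axis j 1 + axis j 1 = \<alpha>" if "\<alpha> $ j \<noteq> 0" for \<alpha> :: "nat ^ 'd"
      using that by (auto simp: vec_eq_iff axis_def)
    then show "\<alpha> - axis j 1 + axis j 1 = \<alpha>"
      if "\<alpha> \<in> {\<alpha>. mi_size \<alpha> = Suc N} - {\<alpha>. mi_size \<alpha> = Suc N \<and> \<alpha> $ j = 0}" for \<alpha> :: "nat ^ 'd"
      using that by simp
    show "\<alpha> - axis j 1 \<in> {\<beta>. mi_size \<beta> = N} - {}"
      if "\<alpha> \<in> {\<alpha>. mi_size \<alpha> = Suc N} - {\<alpha>. mi_size \<alpha> = Suc N \<and> \<alpha> $ j = 0}" for \<alpha> :: "nat ^ 'd"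
      using that minus[of \<alpha>] mi_size_add[of "\<alpha> - axis j 1" "axis j 1"] by simp
    show "\<beta> + axis j 1 \<in> {\<alpha>. mi_size \<alpha> = Suc N} - {\<alpha>. mi_size \<alpha> = Suc N \<and> \<alpha> $ j = 0}"
      if "\<beta> \<in> {\<beta>. mi_size \<beta> = N} - {}" for \<beta> :: "nat ^ 'd"
      using that mi_size_add[of \<beta> "axis j 1"] by simp
    show "real ((\<beta> + axis j 1) $ j) * mi_weight x (\<beta> + axis j 1) = x $ j * mi_weight x \<beta>"
      for \<beta> :: "nat ^ 'd"
      by (rule mi_weight_add_axis)
  qed (auto simp: finite_mi_size)
  have "real (Suc N) * (\<Sum>\<alpha> | mi_size \<alpha> = Suc N. mi_weight x \<alpha>)
      = (\<Sum>\<alpha> | mi_size \<alpha> = Suc N. \<Sum>j\<in>UNIV. real (\<alpha> $ j) * mi_weight x \<alpha>)"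
  proof -
    have "real (Suc N) * mi_weight x \<alpha> = (\<Sum>j\<in>UNIV. real (\<alpha> $ j) * mi_weight x \<alpha>)"
      if "mi_size \<alpha> = Suc N" for \<alpha>
      unfolding that[symmetric] by (simp add: mi_size_def sum_distrib_right)
    then show ?thesis
      by (simp add: sum_distrib_left)
  qed
  also have "\<dots> = (\<Sum>j\<in>UNIV. \<Sum>\<beta> | mi_size \<beta> = N. x $ j * mi_weight x \<beta>)"
    by (subst sum.swap) (simp add: shift)
  also have "\<dots> = (\<Sum>j\<in>UNIV. x $ j) * (\<Sum>\<beta> | mi_size \<beta> = N. mi_weight x \<beta>)"
    by (simp add: sum_product)
  finally have "real (Suc N) * (\<Sum>\<alpha> | mi_size \<alpha> = Suc N. mi_weight x \<alpha>)
      = (\<Sum>j\<in>UNIV. x $ j) ^ Suc N / fact N"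
    unfolding Suc.IH by simp
  then show ?case
    by (simp add: nonzero_eq_divide_eq eq_divide_eq mult_ac del: of_nat_Suc)
qed

section \<open>The shell norms \<open>h_coef\<close> and boundedness of the matrices built from
  them\<close>

lemma h_coef_eq_L2_set:
  "h_coef \<rho> N = L2_set (mi_weight ((1 / 2) *\<^sub>R \<rho>)) {\<alpha>. mi_size \<alpha> = N}"
  unfolding h_coef_def L2_set_def
  by (intro arg_cong[of _ _ sqrt] sum.cong refl)
    (simp add: mi_weight_def power_even_eq prod_power_distrib power_divide)

lemma h_coef_nonneg: "0 \<le> h_coef \<rho> N"
  by (simp add: h_coef_eq_L2_set)

lemma mi_weight_nonneg: "(\<And>j. 0 \<le> x $ j) \<Longrightarrow> 0 \<le> mi_weight x \<alpha>"
  by (simp add: mi_weight_def mi_fact_def prod_nonneg)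

text \<open>For nonnegative weights the Euclidean norm is at most the sum, which the multinomial
  theorem evaluates.\<close>

lemma h_coef_le:
  assumes "\<And>j. 0 \<le> \<rho> $ j"
  shows "h_coef \<rho> N \<le> (R_of \<rho> / 2) ^ N / fact N"
proof -
  have "h_coef \<rho> N \<le> (\<Sum>\<alpha> | mi_size \<alpha> = N. mi_weight ((1 / 2) *\<^sub>R \<rho>) \<alpha>)"
    unfolding h_coef_eq_L2_set using assms by (intro L2_set_le_sum mi_weight_nonneg) simp
  also have "\<dots> = (R_of \<rho> / 2) ^ N / fact N"
    by (simp add: sum_mi_weight R_of_def sum_divide_distrib)
  finally show ?thesis .
qed

text \<open>The entries are prescribed only up to sign, so that the signed matrix of
  \<open>B_tilde\<close> and the unsigned one of \<open>B_op\<close> are covered together.\<close>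

lemma fact_h_coef_row:
  fixes M :: "nat \<Rightarrow> nat \<Rightarrow> real"
  assumes \<rho>: "\<rho> \<in> param_simplex"
    and M: "\<And>n m. \<bar>M n m\<bar> = fact (n + m) * h_coef \<rho> n * h_coef \<rho> m"
  shows "(\<lambda>m. \<bar>M n m\<bar>) summable_on UNIV" "(\<Sum>\<^sub>\<infinity>m. \<bar>M n m\<bar>) \<le> 2"
proof -
  have \<rho>0: "0 \<le> \<rho> $ j" for j
    using \<rho> by (simp add: param_simplex_def)
  have R: "0 \<le> R_of \<rho> / 2" "R_of \<rho> / 2 \<le> 1 / 2"
    using \<rho> \<rho>0 by (auto simp: param_simplex_def R_of_def intro: sum_nonneg)
  have le: "\<bar>M n m\<bar> \<le> real ((n + m) choose n) * (1 / 2) ^ (n + m)" for m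
  proof -
    have "\<bar>M n m\<bar> \<le> fact (n + m) * ((R_of \<rho> / 2) ^ n / fact n) * ((R_of \<rho> / 2) ^ m / fact m)"
      unfolding M using \<rho>0 R by (intro mult_mono h_coef_le h_coef_nonneg) (auto simp: h_coef_nonneg)
    also have "\<dots> = real ((n + m) choose n) * (R_of \<rho> / 2) ^ (n + m)"
      by (simp add: binomial_fact power_add)
    also have "\<dots> \<le> real ((n + m) choose n) * (1 / 2) ^ (n + m)"
      using R by (intro mult_left_mono power_mono) auto
    finally show ?thesis .
  qed
  have half: "(\<lambda>m. real ((n + m) choose n) * (1 / 2) ^ (n + m)) summable_on UNIV"
    using choose_half_has_sum has_sum_imp_summable by blast
  then show summable: "(\<lambda>m. \<bar>M n m\<bar>) summable_on UNIV"
    by (rule summable_on_comparison_test) (auto simp: le)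
  show "(\<Sum>\<^sub>\<infinity>m. \<bar>M n m\<bar>) \<le> 2"
    using infsum_mono[OF summable half le] infsumI[OF choose_half_has_sum, of n] by simp
qed

lemma bounded_operator_fact_h_coef:
  fixes M :: "nat \<Rightarrow> nat \<Rightarrow> real"
  assumes "\<rho> \<in> param_simplex" "\<And>n m. \<bar>M n m\<bar> = fact (n + m) * h_coef \<rho> n * h_coef \<rho> m"
  shows "bounded_operator l2 (matrix_op M)"
  by (rule Schur_test[of _ 2]) (use fact_h_coef_row[OF assms] in \<open>auto simp: assms(2) add.commute\<close>)

lemma abs_B_tilde_entry:
  "\<bar>(- 1) ^ (n + m) * fact (n + m) * h_coef \<rho> n * h_coef \<rho> m\<bar> = fact (n + m) * h_coef \<rho> n * h_coef \<rho> m"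
  by (simp add: abs_mult power_abs h_coef_nonneg)

text \<open>If \<open>h_coef \<rho> N = 0\<close>, which happens only for \<open>\<rho> = 0\<close>, any unit vector supported on the shell
  \<open>|\<alpha>| = N\<close> will do.\<close>

definition shell_vector :: "real ^ 'd \<Rightarrow> nat ^ 'd \<Rightarrow> real" where
  "shell_vector \<rho> \<alpha> = (let h = h_coef \<rho> (mi_size \<alpha>) in
     if h = 0 then of_bool (\<alpha> = axis undefined (mi_size \<alpha>)) else mi_weight ((1 / 2) *\<^sub>R \<rho>) \<alpha> / h)"

text \<open>If the shell norm is 0, all weights on the shell vanish, so the substitute unit vector
  does no harm.\<close>

lemma h_coef_shell_vector: "h_coef \<rho> (mi_size \<alpha>) * shell_vector \<rho> \<alpha> = mi_weight ((1 / 2) *\<^sub>R \<rho>) \<alpha>"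
proof (cases "h_coef \<rho> (mi_size \<alpha>) = 0")
  case True
  then show ?thesis
    by (simp add: h_coef_eq_L2_set L2_set_eq_0_iff finite_mi_size)
qed (simp add: shell_vector_def Let_def)

lemma shell_vector_unit:
  fixes \<rho> :: "real ^ 'd"
  shows "(\<Sum>\<alpha> | mi_size \<alpha> = N. (shell_vector \<rho> \<alpha>)\<^sup>2) = 1"
proof (cases "h_coef \<rho> N = 0")
  case True
  \<comment> \<open>Here \<open>undefined\<close> stands for an arbitrary coordinate; whichever it
    is, \<open>axis undefined N\<close> lies on the shell of size \<open>N\<close>.\<close>
  then have "(\<Sum>\<alpha> | mi_size \<alpha> = N. (shell_vector \<rho> \<alpha>)\<^sup>2)
      = (\<Sum>\<alpha> :: nat ^ 'd | mi_size \<alpha> = N. if \<alpha> = axis undefined N then 1 else 0)"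
    by (intro sum.cong) (auto simp: shell_vector_def)
  then show ?thesis
    by (simp add: finite_mi_size)
next
  case False
  then have "(\<Sum>\<alpha> | mi_size \<alpha> = N. (shell_vector \<rho> \<alpha>)\<^sup>2)
      = (\<Sum>\<alpha> | mi_size \<alpha> = N. (mi_weight ((1 / 2) *\<^sub>R \<rho>) \<alpha>)\<^sup>2) / (h_coef \<rho> N)\<^sup>2"
    unfolding sum_divide_distrib
    by (intro sum.cong) (auto simp: shell_vector_def power_divide)
  also have "(\<Sum>\<alpha> | mi_size \<alpha> = N. (mi_weight ((1 / 2) *\<^sub>R \<rho>) \<alpha>)\<^sup>2) = (h_coef \<rho> N)\<^sup>2"
    by (simp add: h_coef_eq_L2_set L2_set_def sum_nonneg)
  finally show ?thesis
    using False by simp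
qed

section \<open>Factorisation of the operators and the two equivalences\<close>

interpretation shell: fibre_vectors mi_size "shell_vector \<rho>" for \<rho> :: "real ^ 'd"
  by unfold_locales (auto simp: finite_mi_size shell_vector_unit)

text \<open>Splitting each weight into shell norm times unit vector brings the matrix into the form
  to which \<open>matrix_op_emb\<close> applies.\<close>

lemma calH_eq:
  "calH \<rho> = matrix_op (\<lambda>\<alpha> \<beta>. shell_vector \<rho> \<alpha> * shell_vector \<rho> \<beta> *
     ((- 1) ^ (mi_size \<alpha> + mi_size \<beta>) * fact (mi_size \<alpha> + mi_size \<beta>) *
       h_coef \<rho> (mi_size \<alpha>) * h_coef \<rho> (mi_size \<beta>)))"
proof -
  have entry: "(\<Prod>j\<in>UNIV. (\<rho> $ j / 2) ^ (\<alpha> $ j + \<beta> $ j)) / (mi_fact \<alpha> * mi_fact \<beta>)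
      = (h_coef \<rho> (mi_size \<alpha>) * shell_vector \<rho> \<alpha>) * (h_coef \<rho> (mi_size \<beta>) * shell_vector \<rho> \<beta>)"
    for \<alpha> \<beta> :: "nat ^ 'a"
    unfolding h_coef_shell_vector
    by (simp add: mi_weight_def power_add prod.distrib)
  have regroup: "s * (f / m) * q = s * f * (q / m)" for s f m q :: real
    by simp
  show ?thesis
    unfolding calH_def regroup entry by (simp only: mult_ac)
qed

text \<open>The denominators of the two \<open>c_coef\<close> cancel the powers of \<open>t\<close>
  and the factorials hidden in the binomial coefficient. What remains is the matrix of
  \<open>B_tilde\<close> without its signs.\<close>

lemma B_op_eq:
  assumes "R_of \<rho> \<noteq> 0"
  shows "B_op \<rho> = matrix_op (\<lambda>n m. fact (n + m) * h_coef \<rho> n * h_coef \<rho> m)"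
proof (intro ext)
  fix x :: "nat \<Rightarrow> complex" and n
  define t where "t = R_of \<rho> / 2"
  have c: "h_coef \<rho> k = c_coef \<rho> k * (t ^ k / fact k)" for k
    using assms by (simp add: c_coef_def t_def)
  have entry: "c_coef \<rho> n * (real ((n + m) choose n) * t ^ (n + m)) * c_coef \<rho> m
      = fact (n + m) * h_coef \<rho> n * h_coef \<rho> m" for m
    unfolding c by (simp add: binomial_fact power_add)
  have "B_op \<rho> x n = (\<Sum>\<^sub>\<infinity>m. complex_of_real (c_coef \<rho> n) *
      (complex_of_real (real ((n + m) choose n) * t ^ (n + m)) * (complex_of_real (c_coef \<rho> m) * x m)))"
    by (simp add: B_op_def D_op_def H_op_def diag_op_def matrix_op_def t_def infsum_cmult_right')
  also have "\<dots> = matrix_op (\<lambda>n m. fact (n + m) * h_coef \<rho> n * h_coef \<rho> m) x n"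
    unfolding matrix_op_def entry[symmetric] by (simp add: mult.assoc)
  finally show "B_op \<rho> x n = matrix_op (\<lambda>n m. fact (n + m) * h_coef \<rho> n * h_coef \<rho> m) x n" .
qed

lemma unitary_diag_op:
  fixes w :: "'i \<Rightarrow> complex"
  assumes w: "\<And>i. cmod (w i) = 1"
  shows "unitary l2 l2 (diag_op w)"
proof -
  have ww: "w i * cnj (w i) = 1" "cnj (w i) * w i = 1" for i
    using w by (simp_all add: complex_norm_square[symmetric] mult.commute)
  have "bij_betw (diag_op w) (vecs l2) (vecs l2)"
    by (rule bij_betw_byWitness[where f' = "diag_op (\<lambda>i. cnj (w i))"])
      (auto simp: diag_op_def norm_mult w ww fun_eq_iff mult.assoc[symmetric])
  moreover have "ip l2 (diag_op w x) (diag_op w y) = ip l2 x y" for x y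
  proof -
    have "w i * x i * cnj (w i * y i) = w i * cnj (w i) * (x i * cnj (y i))" for i
      by simp
    then show ?thesis
      by (simp only: diag_op_def l2_simps ww mult_1_left)
  qed
  ultimately show ?thesis
    unfolding unitary_def linear_map_def
    by (auto simp: diag_op_def[abs_def] norm_mult w fun_eq_iff algebra_simps simp del: l2_simps(3))
qed

theorem theorem3p9:
  fixes \<rho> :: "real ^ ('d::finite)"
  assumes "\<rho> \<in> param_simplex"
  shows "(\<exists>K :: (nat ^ 'd \<Rightarrow> complex) cspace. hilbert_space K \<and>
            unitarily_equivalent l2 (calH \<rho>)
              (direct_sum l2 K) (direct_sum_op (B_tilde \<rho>) zero_op)) \<and>
         (\<rho> \<noteq> 0 \<longrightarrow>
            (\<exists>w. unitarily_equivalent_by (diag_op w) l2 (B_tilde \<rho>) l2 (B_op \<rho>)))"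
proof (intro conjI impI)
  let ?B = "\<lambda>n m. (- 1) ^ (n + m) * fact (n + m) * h_coef \<rho> n * h_coef \<rho> m"
  have B_tilde: "bounded_operator l2 (B_tilde \<rho>)"
    unfolding B_tilde_def by (rule bounded_operator_fact_h_coef[OF assms abs_B_tilde_entry])
  have "calH \<rho> x = shell.emb \<rho> (B_tilde \<rho> (shell.coemb \<rho> x))" if "x \<in> vecs l2" for x
    using shell.matrix_op_emb[of ?B, OF fact_h_coef_row(1)[OF assms abs_B_tilde_entry] that]
    unfolding calH_eq B_tilde_def by blast
  then have "unitarily_equivalent l2 (calH \<rho>) (direct_sum l2 (shell.coemb_kernel \<rho>))
      (direct_sum_op (B_tilde \<rho>) zero_op)"
    using B_tilde by (rule shell.unitarily_equivalent_direct_sum_zero)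
  then show "\<exists>K :: (nat ^ 'd \<Rightarrow> complex) cspace. hilbert_space K \<and>
      unitarily_equivalent l2 (calH \<rho>) (direct_sum l2 K) (direct_sum_op (B_tilde \<rho>) zero_op)"
    using shell.hilbert_space_coemb_kernel by blast

  assume "\<rho> \<noteq> 0"
  \<comment> \<open>Coordinates in the simplex are nonnegative, so their sum vanishes only at the
    origin.\<close>
  then have R: "R_of \<rho> \<noteq> 0"
    using assms by (auto simp: R_of_def param_simplex_def sum_nonneg_eq_0_iff vec_eq_iff)
  \<comment> \<open>Since \<open>(- 1) ^ n * (- 1) ^ (n + m) = (- 1) ^ m\<close>, this diagonal
    carries the signs of \<open>B_tilde\<close> over to the argument.\<close>
  let ?w = "\<lambda>n. (- 1) ^ n :: complex"
  have "bounded_operator l2 (B_op \<rho>)"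
    unfolding B_op_eq[OF R] using assms
    by (rule bounded_operator_fact_h_coef) (simp add: h_coef_nonneg)
  moreover have "diag_op ?w (B_tilde \<rho> x) = B_op \<rho> (diag_op ?w x)" for x
    unfolding B_op_eq[OF R]
    by (auto simp: B_tilde_def matrix_op_def diag_op_def fun_eq_iff power_add mult_ac
        simp flip: infsum_cmult_right' intro!: infsum_cong)
  moreover have "unitary l2 l2 (diag_op ?w)"
    by (rule unitary_diag_op) (simp add: norm_power)
  ultimately show "\<exists>w. unitarily_equivalent_by (diag_op w) l2 (B_tilde \<rho>) l2 (B_op \<rho>)"
    unfolding unitarily_equivalent_by_def using B_tilde by blast
qed

end
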